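(* As formal power series in $q$, $$\sum_{n\geq 0}M_n(u_1,u_2,u_3;v_1,v_2;t)q^n=\frac{t^{-1}-v_1q+(u_3-u_1)q^2-\sqrt{t^{-2}-2t^{-1}v_1q+(v_1^2-2t^{-1}(u_1+u_3))q^2+(2u_1v_1+2u_3v_1-4u_2v_2)q^3+(u_1-u_3)^2q^4}}{2q^2},$$ where the square root is the power series in $q$ with constant term $t^{-1}$.
   Context: A plane tree is an unlabeled rooted tree in which the children of every vertex are linearly ordered. A leaf is a vertex with no children, an interior vertex one with at least one child. A tip-augmented plane tree is a plane tree in which the leftmost child of every interior vertex is a leaf; $\mathcal T_m$ is the set of tip-augmented plane trees with $m$ edges. In such a tree: a leaf without siblings is a singleton leaf; a leaf with siblings that is the leftmost child of its parent is an elder twin leaf if the second child of its parent is a leaf, and an elder non-twin leaf otherwise; a leaf with siblings that is the second child is a second leaf; a leaf with siblings that is neither first nor second child is a younger leaf. An edge is a young edge if its lower endpoint is not a singleton, elder twin or elder non-twin leaf. Let $\mathrm{sleaf},\mathrm{etleaf},\mathrm{entleaf},\mathrm{syleaf},\mathrm{yerleaf},\mathrm{yedge}$ count singleton, elder twin, elder non-twin, second and younger leaves and young edges. For $n\ge1$, $M_n(u_1,u_2,u_3;v_1,v_2;t)=\sum_{T\in\mathcal T_{n+1}}u_1^{\mathrm{sleaf}(T)}u_2^{\mathrm{etleaf}(T)}u_3^{\mathrm{entleaf}(T)}v_1^{\mathrm{yerleaf}(T)}v_2^{\mathrm{syleaf}(T)}t^{\mathrm{yedge}(T)}$, and by convention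 $M_0(u_1,u_2,u_3;v_1,v_2;t)=u_3$. *)

theory Defs
  imports "HOL-Computational_Algebra.Formal_Power_Series"
begin

datatype ptree = Node (children: "ptree list")

text \<open>
  A vertex is addressed by the path leading to it from the root: \<open>[]\<close> is the root and \<open>p @ [i]\<close> is the
  child number \<open>i\<close> of \<open>p\<close>, counting from the left and starting at \<open>0\<close>. Hence, for a
  vertex \<open>p \<noteq> []\<close>, its parent is \<open>butlast p\<close> and its position among the siblings is \<open>last p\<close>.
\<close>

fun is_vertex :: "ptree \<Rightarrow> nat list \<Rightarrow> bool" where
  "is_vertex T [] \<longleftrightarrow> True"
| "is_vertex T (i # p) \<longleftrightarrow> i < length (children T) \<and> is_vertex (children T ! i) p"

fun subtree :: "ptree \<Rightarrow> nat list \<Rightarrow> ptree" where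
  "subtree T [] = T"
| "subtree T (i # p) = subtree (children T ! i) p"

definition vertices :: "ptree \<Rightarrow> nat list set" where
  "vertices T = {p. is_vertex T p}"

definition num_children :: "ptree \<Rightarrow> nat list \<Rightarrow> nat" where
  "num_children T p = length (children (subtree T p))"

definition edges :: "ptree \<Rightarrow> (nat list \<times> nat list) set" where
  "edges T = {(p, p @ [i]) | p i. p \<in> vertices T \<and> i < num_children T p}"

definition leaves :: "ptree \<Rightarrow> nat list set" where
  "leaves T = {p \<in> vertices T. num_children T p = 0}"

definition interior_vertices :: "ptree \<Rightarrow> nat list set" where
  "interior_vertices T = {p \<in> vertices T. num_children T p \<ge> 1}"

definition tip_augmented :: "ptree \<Rightarrow> bool" where
  "tip_augmented T \<longleftrightarrow> (\<forall>p \<in> interior_vertices T. p @ [0] \<in> leaves T)"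

definition tip_augmented_trees :: "nat \<Rightarrow> ptree set" where
  "tip_augmented_trees m = {T. tip_augmented T \<and> card (edges T) = m}"

definition has_siblings :: "ptree \<Rightarrow> nat list \<Rightarrow> bool" where
  "has_siblings T p \<longleftrightarrow> p \<noteq> [] \<and> num_children T (butlast p) \<ge> 2"

definition singleton_leaves :: "ptree \<Rightarrow> nat list set" where
  "singleton_leaves T = {p \<in> leaves T. \<not> has_siblings T p}"

definition elder_twin_leaves :: "ptree \<Rightarrow> nat list set" where
  "elder_twin_leaves T =
     {p \<in> leaves T. has_siblings T p \<and> last p = 0 \<and> butlast p @ [1] \<in> leaves T}"

definition elder_nontwin_leaves :: "ptree \<Rightarrow> nat list set" where
  "elder_nontwin_leaves T =
     {p \<in> leaves T. has_siblings T p \<and> last p = 0 \<and> butlast p @ [1] \<notin> leaves T}"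

definition second_leaves :: "ptree \<Rightarrow> nat list set" where
  "second_leaves T = {p \<in> leaves T. has_siblings T p \<and> last p = 1}"

definition younger_leaves :: "ptree \<Rightarrow> nat list set" where
  "younger_leaves T = {p \<in> leaves T. has_siblings T p \<and> last p \<noteq> 0 \<and> last p \<noteq> 1}"

definition young_edges :: "ptree \<Rightarrow> (nat list \<times> nat list) set" where
  "young_edges T =
     {(p, c) \<in> edges T. c \<notin> singleton_leaves T \<union> elder_twin_leaves T \<union> elder_nontwin_leaves T}"

definition sleaf :: "ptree \<Rightarrow> nat" where "sleaf T = card (singleton_leaves T)"
definition etleaf :: "ptree \<Rightarrow> nat" where "etleaf T = card (elder_twin_leaves T)"
definition entleaf :: "ptree \<Rightarrow> nat" where "entleaf T = card (elder_nontwin_leaves T)"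
definition syleaf :: "ptree \<Rightarrow> nat" where "syleaf T = card (second_leaves T)"
definition yerleaf :: "ptree \<Rightarrow> nat" where "yerleaf T = card (younger_leaves T)"
definition yedge :: "ptree \<Rightarrow> nat" where "yedge T = card (young_edges T)"

text \<open>
  The variables are arbitrary elements of a commutative semiring; taking them to be indeterminates
  (e.g. in a nested polynomial ring or its field of fractions) gives the formal polynomial.
\<close>

definition M :: "nat \<Rightarrow> 'a \<Rightarrow> 'a \<Rightarrow> 'a \<Rightarrow> 'a \<Rightarrow> 'a \<Rightarrow> 'a \<Rightarrow> 'a::comm_semiring_1" where
  "M n u1 u2 u3 v1 v2 t =
     (if n = 0 then u3
      else \<Sum>T \<in> tip_augmented_trees (n + 1).
             u1 ^ sleaf T * u2 ^ etleaf T * u3 ^ entleaf T *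
             v1 ^ yerleaf T * v2 ^ syleaf T * t ^ yedge T)"

end

theory Submission
  imports Defs
begin

text \<open>
  Deleting the root and its leftmost child, which is a leaf, turns a nontrivial tip-augmented tree
  into a forest of tip-augmented trees. The first tree of the forest decides between elder twin and
  elder non-twin, the remaining ones contribute independently. If \<open>Q\<close> is the generating function of
  the trees with at least one edge, where \<open>q\<close> marks all edges but one (so its constant term is
  \<open>u\<^sub>1\<close> instead of the conventional \<open>M\<^sub>0 = u\<^sub>3\<close>), and \<open>H\<close> that of the forests, this gives
  \<open>Q = u\<^sub>1 + q t (u\<^sub>2 v\<^sub>2 + u\<^sub>3 q Q) H\<close> and \<open>H = 1 + q t (v\<^sub>1 + q Q) H\<close>;
  eliminating \<open>H\<close> leaves a quadratic equation whose discriminant is the radicand.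
\<close>

subsection \<open>Vertices and edges\<close>

abbreviation nonroot :: "ptree \<Rightarrow> nat list set" where
  "nonroot T \<equiv> vertices T - {[]}"

lemma Nil_in_vertices [simp]: "[] \<in> vertices T"
  by (simp add: vertices_def)

lemma Cons_in_vertices [simp]:
  "i # p \<in> vertices T \<longleftrightarrow> i < length (children T) \<and> p \<in> vertices (children T ! i)"
  by (simp add: vertices_def)

lemma num_children_Nil [simp]: "num_children T [] = length (children T)"
  by (simp add: num_children_def)

lemma num_children_Cons [simp]: "num_children T (i # p) = num_children (children T ! i) p"
  by (simp add: num_children_def)

lemma Nil_in_leaves [simp]: "[] \<in> leaves T \<longleftrightarrow> children T = []"
  by (simp add: leaves_def)

lemma Cons_in_leaves [simp]:
  "i # p \<in> leaves T \<longleftrightarrow> i < length (children T) \<and> p \<in> leaves (children T ! i)"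
  by (auto simp: leaves_def)

lemma children_Nil_iff [simp]: "children T = [] \<longleftrightarrow> T = Node []"
  by (cases T) auto

lemma snoc_in_vertices: "p @ [i] \<in> vertices T \<longleftrightarrow> p \<in> vertices T \<and> i < num_children T p"
  by (induction p arbitrary: T) auto

lemma nonroot_Node: "nonroot (Node ts) = (\<Union>i<length ts. (#) i ` vertices (ts ! i))"
proof (rule set_eqI)
  fix p show "p \<in> nonroot (Node ts) \<longleftrightarrow> p \<in> (\<Union>i<length ts. (#) i ` vertices (ts ! i))"
    by (cases p) auto
qed

lemma finite_vertices [simp]: "finite (vertices T)"
proof (induction T)
  case (Node ts)
  then have "finite (nonroot (Node ts))"
    unfolding nonroot_Node by (auto intro!: finite_UN_I finite_imageI)
  then show ?case by (simp only: finite_Diff_insert finite_Diff2 finite.emptyI Diff_empty)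
qed

text \<open>Stated for an arbitrary commutative monoid because it serves twice:
  \<open>sum.nonroot\<close> counts edges and \<open>prod.nonroot\<close> multiplies
  weights.\<close>

lemma (in comm_monoid_set) nonroot:
  "F g (nonroot (Node ts)) = F (\<lambda>i. g [i] \<^bold>* F (\<lambda>p. g (i # p)) (nonroot (ts ! i))) {..<length ts}"
proof -
  have "F g (nonroot (Node ts)) = F (\<lambda>i. F g ((#) i ` vertices (ts ! i))) {..<length ts}"
    unfolding nonroot_Node by (rule UNION_disjoint) auto
  also have "\<dots> = F (\<lambda>i. F (\<lambda>p. g (i # p)) (vertices (ts ! i))) {..<length ts}"
    by (rule cong[OF refl]) (simp add: reindex)
  also have "\<dots> = F (\<lambda>i. g [i] \<^bold>* F (\<lambda>p. g (i # p)) (nonroot (ts ! i))) {..<length ts}"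
    by (rule cong[OF refl]) (rule remove, simp_all)
  finally show ?thesis .
qed

text \<open>An edge is determined by its lower endpoint, which can be any vertex but the root, so
  edge counts become vertex counts.\<close>

lemma edges_eq: "edges T = (\<lambda>p. (butlast p, p)) ` nonroot T"
proof (rule set_eqI, rule iffI)
  fix e assume "e \<in> edges T"
  then obtain p i where e: "e = (p, p @ [i])" and "p @ [i] \<in> vertices T"
    by (auto simp: edges_def snoc_in_vertices)
  then show "e \<in> (\<lambda>p. (butlast p, p)) ` nonroot T"
    by (intro image_eqI[where x = "p @ [i]"]) auto
next
  fix e assume "e \<in> (\<lambda>p. (butlast p, p)) ` nonroot T"
  then obtain p where p: "p \<in> vertices T" "p \<noteq> []" and e: "e = (butlast p, p)" by auto
  then have *: "butlast p @ [last p] \<in> vertices T" by simp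
  show "e \<in> edges T"
    using p * unfolding edges_def e snoc_in_vertices
    by (intro CollectI exI[where x = "butlast p"] exI[where x = "last p"]) simp
qed

lemma card_edges: "card (edges T) = card (nonroot T)"
  unfolding edges_eq by (rule card_image) (auto intro: inj_onI)

lemma card_edges_Node: "card (edges (Node ts)) = (\<Sum>s\<leftarrow>ts. Suc (card (edges s)))"
proof -
  have "card (edges (Node ts)) = (\<Sum>i<length ts. Suc (card (nonroot (ts ! i))))"
    unfolding card_edges unfolding card_eq_sum sum.nonroot by (simp only: plus_1_eq_Suc)
  then show ?thesis
    by (simp add: card_edges sum_list_sum_nth atLeast0LessThan)
qed

lemma tip_augmented_Node:
  "tip_augmented (Node ts) \<longleftrightarrow>
     (ts = [] \<or> hd ts = Node []) \<and> (\<forall>s\<in>set ts. tip_augmented s)" (is "?l \<longleftrightarrow> ?r")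
proof -
  have tip: "tip_augmented T \<longleftrightarrow> (\<forall>p\<in>vertices T. num_children T p \<ge> 1 \<longrightarrow> p @ [0] \<in> leaves T)" for T
    by (auto simp: tip_augmented_def interior_vertices_def)
  have "vertices (Node ts) = insert [] (\<Union>i<length ts. (#) i ` vertices (ts ! i))"
    using nonroot_Node[of ts] by (auto simp del: Cons_in_vertices)
  then have "?l \<longleftrightarrow> (ts = [] \<or> ts ! 0 = Node []) \<and> (\<forall>i<length ts. tip_augmented (ts ! i))"
    unfolding tip by (auto simp: Suc_le_eq)
  moreover have "(ts = [] \<or> ts ! 0 = Node []) \<longleftrightarrow> (ts = [] \<or> hd ts = Node [])"
    by (cases ts) simp_all
  ultimately show ?thesis
    unfolding all_set_conv_all_nth by simp
qed

subsection \<open>Multiplicative weights\<close>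

context
  fixes u1 u2 u3 v1 v2 t :: "'a :: comm_semiring_1"
begin

text \<open>A non-root vertex also carries the edge above it: the factor \<open>t\<close> is absent
  exactly for singleton and elder leaves, whose edges are not young.\<close>

definition vertex_weight :: "ptree \<Rightarrow> nat list \<Rightarrow> 'a" where
  "vertex_weight T p =
     (if p \<notin> leaves T then t
      else if \<not> has_siblings T p then u1
      else if last p = 0 then if butlast p @ [1] \<in> leaves T then u2 else u3
      else if last p = 1 then v2 * t else v1 * t)"

definition tree_weight :: "ptree \<Rightarrow> 'a" where
  "tree_weight T = (\<Prod>p\<in>nonroot T. vertex_weight T p)"

lemma power_card_eq_prod_if:
  assumes "finite V" "A \<subseteq> V"
  shows "(c :: 'a) ^ card A = (\<Prod>p\<in>V. if p \<in> A then c else 1)"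
  using assms by (simp add: prod.If_cases Int_absorb1)

text \<open>The one-vertex tree is excluded because its root counts as a singleton leaf.\<close>

lemma monomial_eq_tree_weight:
  assumes "T \<noteq> Node []"
  shows "u1 ^ sleaf T * u2 ^ etleaf T * u3 ^ entleaf T * v1 ^ yerleaf T * v2 ^ syleaf T * t ^ yedge T
         = tree_weight T"
proof -
  let ?elder = "singleton_leaves T \<union> elder_twin_leaves T \<union> elder_nontwin_leaves T"
  have "leaves T \<subseteq> nonroot T"
    using assms by (auto simp: leaves_def)
  then have sub: "singleton_leaves T \<subseteq> nonroot T" "elder_twin_leaves T \<subseteq> nonroot T"
      "elder_nontwin_leaves T \<subseteq> nonroot T" "younger_leaves T \<subseteq> nonroot T"
      "second_leaves T \<subseteq> nonroot T"
    by (auto simp: singleton_leaves_def elder_twin_leaves_def elder_nontwin_leaves_def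
          younger_leaves_def second_leaves_def)
  have "young_edges T = (\<lambda>p. (butlast p, p)) ` (nonroot T - ?elder)"
    unfolding young_edges_def edges_eq by auto
  then have yedge: "yedge T = card (nonroot T - ?elder)"
    unfolding yedge_def by (simp only:) (rule card_image, auto intro: inj_onI)
  show ?thesis
    unfolding yedge sleaf_def etleaf_def entleaf_def yerleaf_def syleaf_def tree_weight_def
    \<comment> \<open>All six powers become products over one common index set, so the claim can be
      checked vertex by vertex.\<close>
    apply (subst (1 2 3 4 5 6) power_card_eq_prod_if[where V = "nonroot T"])
    using sub apply (simp_all add: prod.distrib[symmetric] del: prod.distrib)
    apply (intro prod.cong refl)
    apply (auto simp: vertex_weight_def singleton_leaves_def elder_twin_leaves_def
        elder_nontwin_leaves_def younger_leaves_def second_leaves_def)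
    done
qed

text \<open>For \<open>p \<noteq> []\<close> the parent already lies in \<open>ts ! i\<close>, so
  the siblings are visible there; the class of a child \<open>[i]\<close> depends on the whole
  tree.\<close>

lemma vertex_weight_Cons:
  "i < length ts \<Longrightarrow> p \<noteq> [] \<Longrightarrow> vertex_weight (Node ts) (i # p) = vertex_weight (ts ! i) p"
  by (simp add: vertex_weight_def has_siblings_def)

lemma tree_weight_Node:
  "tree_weight (Node ts) = (\<Prod>i<length ts. vertex_weight (Node ts) [i] * tree_weight (ts ! i))"
  unfolding tree_weight_def prod.nonroot
  by (intro prod.cong refl arg_cong2[where f = "(*)"]) (simp add: vertex_weight_Cons)

lemma tree_weight_leaf [simp]: "tree_weight (Node []) = 1"
  by (simp add: tree_weight_Node)

lemma tree_weight_singleton: "tree_weight (Node [Node []]) = u1"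
  by (simp add: tree_weight_Node vertex_weight_def has_siblings_def)

text \<open>The factor of the leftmost leaf is absorbed here, since whether that leaf is a twin
  depends only on the second subtree \<open>s\<close>.\<close>

definition second_weight :: "ptree \<Rightarrow> 'a" where
  "second_weight s = t * (if s = Node [] then u2 * v2 else u3 * tree_weight s)"

definition younger_weight :: "ptree \<Rightarrow> 'a" where
  "younger_weight s = t * (if s = Node [] then v1 else tree_weight s)"

lemma tree_weight_Cons_Cons:
  "tree_weight (Node (Node [] # s # ts)) = second_weight s * (\<Prod>r\<leftarrow>ts. younger_weight r)"
proof -
  let ?T = "Node (Node [] # s # ts)"
  have "tree_weight ?T = vertex_weight ?T [0] * (vertex_weight ?T [1] * tree_weight s) *
          (\<Prod>i<length ts. vertex_weight ?T [Suc (Suc i)] * tree_weight (ts ! i))"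
    by (simp add: tree_weight_Node prod.lessThan_Suc_shift mult.assoc del: prod.lessThan_Suc)
  also have "vertex_weight ?T [0] * (vertex_weight ?T [1] * tree_weight s) = second_weight s"
    by (auto simp: vertex_weight_def second_weight_def has_siblings_def ac_simps)
  also have "(\<Prod>i<length ts. vertex_weight ?T [Suc (Suc i)] * tree_weight (ts ! i)) =
             (\<Prod>i<length ts. younger_weight (ts ! i))"
    by (intro prod.cong refl) (auto simp: vertex_weight_def younger_weight_def has_siblings_def ac_simps)
  also have "\<dots> = (\<Prod>r\<leftarrow>ts. younger_weight r)"
    by (simp add: prod.list_conv_set_nth atLeast0LessThan)
  finally show ?thesis .
qed

end

subsection \<open>Forests\<close>

text \<open>The size of a forest counts its vertices, i.e. each tree comes with an edge above its root.\<close>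

definition forests :: "nat \<Rightarrow> ptree list set" where
  "forests m = {ts. (\<forall>s\<in>set ts. tip_augmented s) \<and> (\<Sum>s\<leftarrow>ts. Suc (card (edges s))) = m}"

lemma tip_augmented_trees_0: "tip_augmented_trees 0 = {Node []}"
proof (rule set_eqI)
  fix T show "T \<in> tip_augmented_trees 0 \<longleftrightarrow> T \<in> {Node []}"
  proof (cases T)
    case (Node ts)
    then show ?thesis
      by (cases ts) (auto simp: tip_augmented_trees_def card_edges_Node tip_augmented_Node)
  qed
qed

text \<open>The leftmost leaf is forced and its edge is the one lost; the other edges at the root
  are those that the forest size counts above its trees.\<close>

lemma tip_augmented_trees_Suc:
  "tip_augmented_trees (Suc m) = (\<lambda>ts. Node (Node [] # ts)) ` forests m"
proof (rule set_eqI)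
  fix T show "T \<in> tip_augmented_trees (Suc m) \<longleftrightarrow> T \<in> (\<lambda>ts. Node (Node [] # ts)) ` forests m"
  proof (cases T)
    case (Node ts)
    then show ?thesis
      by (cases ts) (auto simp: tip_augmented_trees_def forests_def card_edges_Node tip_augmented_Node)
  qed
qed

lemma forests_0: "forests 0 = {[]}"
proof (rule set_eqI)
  fix ts show "ts \<in> forests 0 \<longleftrightarrow> ts \<in> {[]}"
    by (cases ts) (auto simp: forests_def)
qed

lemma forests_Suc:
  "forests (Suc m) = (\<Union>k\<le>m. (\<lambda>(s, ts). s # ts) ` (tip_augmented_trees k \<times> forests (m - k)))"
proof (rule set_eqI)
  fix us
  show "us \<in> forests (Suc m) \<longleftrightarrow>
          us \<in> (\<Union>k\<le>m. (\<lambda>(s, ts). s # ts) ` (tip_augmented_trees k \<times> forests (m - k)))"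
  proof (cases us)
    case Nil
    then show ?thesis by (auto simp: forests_def)
  next
    case (Cons s ts)
    have "us \<in> forests (Suc m) \<longleftrightarrow>
        (\<exists>k\<le>m. s \<in> tip_augmented_trees k \<and> ts \<in> forests (m - k))"
      unfolding Cons forests_def tip_augmented_trees_def by auto
    then show ?thesis unfolding Cons by auto
  qed
qed

lemma finite_forests: "finite (forests m)"
  and finite_tip_augmented_trees: "finite (tip_augmented_trees m)"
proof -
  \<comment> \<open>Each family is built from the other at smaller sizes, hence one joint
    induction.\<close>
  have "finite (forests m) \<and> finite (tip_augmented_trees m)"
  proof (induction m rule: less_induct)
    case (less m)
    then show ?case
      by (cases m) (auto simp: forests_0 forests_Suc tip_augmented_trees_0 tip_augmented_trees_Suc
            less_Suc_eq_le)
  qed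
  then show "finite (forests m)" "finite (tip_augmented_trees m)" by auto
qed

text \<open>The head has its own weight \<open>f\<close> so that the convolution covers both a
  second subtree and a younger one in front.\<close>

lemma sum_forests_Suc:
  fixes f :: "ptree \<Rightarrow> 'a :: comm_semiring_1" and g :: "ptree list \<Rightarrow> 'a"
  shows "(\<Sum>us\<in>forests (Suc m). f (hd us) * g (tl us)) =
         (\<Sum>k\<le>m. (\<Sum>s\<in>tip_augmented_trees k. f s) * (\<Sum>ts\<in>forests (m - k). g ts))"
proof -
  have "(\<Sum>us\<in>forests (Suc m). f (hd us) * g (tl us)) =
        (\<Sum>k\<le>m. \<Sum>us\<in>(\<lambda>(s, ts). s # ts) ` (tip_augmented_trees k \<times> forests (m - k)).
           f (hd us) * g (tl us))"
    unfolding forests_Suc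
    \<comment> \<open>The union is disjoint because the edge count of the head recovers
      \<open>k\<close>.\<close>
    by (rule sum.UNION_disjoint)
       (auto simp: finite_forests finite_tip_augmented_trees, auto simp: tip_augmented_trees_def)
  also have "\<dots> = (\<Sum>k\<le>m. \<Sum>(s, ts)\<in>tip_augmented_trees k \<times> forests (m - k). f s * g ts)"
    by (intro sum.cong refl, subst sum.reindex) (auto simp: inj_on_def intro!: sum.cong)
  also have "\<dots> = (\<Sum>k\<le>m. (\<Sum>s\<in>tip_augmented_trees k. f s) * (\<Sum>ts\<in>forests (m - k). g ts))"
    by (simp add: sum_product sum.cartesian_product)
  finally show ?thesis .
qed

subsection \<open>Generating functions\<close>

context
  fixes u1 u2 u3 v1 v2 t :: "'a :: comm_semiring_1"
begin

definition tree_fps :: "'a fps" where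
  "tree_fps = Abs_fps (\<lambda>m. \<Sum>T\<in>tip_augmented_trees (Suc m). tree_weight u1 u2 u3 v1 v2 t T)"

text \<open>Even the first tree gets the younger weight: these forests stand to the right of the
  second child.\<close>

definition forest_fps :: "'a fps" where
  "forest_fps = Abs_fps (\<lambda>m. \<Sum>ts\<in>forests m. \<Prod>s\<leftarrow>ts. younger_weight u1 u2 u3 v1 v2 t s)"

text \<open>The one-vertex tree gives the constant term; a tree with \<open>m + 1\<close> edges sits
  at index \<open>m\<close> of \<open>tree_fps\<close>, which \<open>fps_X\<close> corrects.\<close>

lemma second_weight_fps:
  "Abs_fps (\<lambda>k. \<Sum>s\<in>tip_augmented_trees k. second_weight u1 u2 u3 v1 v2 t s) =
   fps_const t * (fps_const (u2 * v2) + fps_const u3 * (fps_X * tree_fps))"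
proof (rule fps_ext)
  fix k
  show "fps_nth (Abs_fps (\<lambda>k. \<Sum>s\<in>tip_augmented_trees k. second_weight u1 u2 u3 v1 v2 t s)) k =
    fps_nth (fps_const t * (fps_const (u2 * v2) + fps_const u3 * (fps_X * tree_fps))) k"
  proof (cases k)
    case (Suc m)
    then show ?thesis
      by (auto simp: second_weight_def tree_fps_def tip_augmented_trees_Suc sum_distrib_left mult.assoc
          intro!: sum.cong)
  qed (simp add: tip_augmented_trees_0 second_weight_def)
qed

lemma younger_weight_fps:
  "Abs_fps (\<lambda>k. \<Sum>s\<in>tip_augmented_trees k. younger_weight u1 u2 u3 v1 v2 t s) =
   fps_const t * (fps_const v1 + fps_X * tree_fps)"
proof (rule fps_ext)
  fix k
  show "fps_nth (Abs_fps (\<lambda>k. \<Sum>s\<in>tip_augmented_trees k. younger_weight u1 u2 u3 v1 v2 t s)) k =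
    fps_nth (fps_const t * (fps_const v1 + fps_X * tree_fps)) k"
  proof (cases k)
    case (Suc m)
    then show ?thesis
      by (auto simp: younger_weight_def tree_fps_def tip_augmented_trees_Suc sum_distrib_left mult.assoc
          intro!: sum.cong)
  qed (simp add: tip_augmented_trees_0 younger_weight_def)
qed

text \<open>A nonempty forest splits into its first tree and the rest; the outer
  \<open>fps_X\<close> pays for the edge above that tree.\<close>

lemma forest_fps_eq:
  "forest_fps = 1 + fps_X * (fps_const t * (fps_const v1 + fps_X * tree_fps)) * forest_fps"
proof (rule fps_ext)
  fix m
  show "fps_nth forest_fps m =
    fps_nth (1 + fps_X * (fps_const t * (fps_const v1 + fps_X * tree_fps)) * forest_fps) m"
  proof (cases m)
    case 0
    then show ?thesis by (simp add: forest_fps_def forests_0 mult.assoc)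
  next
    case (Suc n)
    let ?g = "\<lambda>ts. \<Prod>s\<leftarrow>ts. younger_weight u1 u2 u3 v1 v2 t s"
    have "fps_nth forest_fps m = (\<Sum>us\<in>forests (Suc n). younger_weight u1 u2 u3 v1 v2 t (hd us) * ?g (tl us))"
      unfolding forest_fps_def Suc fps_nth_Abs_fps by (rule sum.cong) (auto simp: forests_Suc)
    also have "\<dots> = fps_nth (fps_const t * (fps_const v1 + fps_X * tree_fps) * forest_fps) n"
      unfolding sum_forests_Suc[of "younger_weight u1 u2 u3 v1 v2 t" ?g] younger_weight_fps[symmetric] fps_mult_nth
      by (simp add: forest_fps_def atLeast0AtMost)
    finally show ?thesis
      by (simp add: Suc mult.assoc)
  qed
qed

text \<open>A root with only its tip gives \<open>u1\<close>; otherwise the second subtree splits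
  off and the later ones form a forest.\<close>

lemma tree_fps_eq:
  "tree_fps = fps_const u1 +
     fps_X * (fps_const t * (fps_const (u2 * v2) + fps_const u3 * (fps_X * tree_fps))) * forest_fps"
proof (rule fps_ext)
  fix m
  have inj: "inj_on (\<lambda>ts. Node (Node [] # ts)) A" for A by (auto intro: inj_onI)
  have nth: "fps_nth tree_fps m = (\<Sum>ts\<in>forests m. tree_weight u1 u2 u3 v1 v2 t (Node (Node [] # ts)))"
    by (simp add: tree_fps_def tip_augmented_trees_Suc sum.reindex[OF inj])
  show "fps_nth tree_fps m = fps_nth (fps_const u1 +
     fps_X * (fps_const t * (fps_const (u2 * v2) + fps_const u3 * (fps_X * tree_fps))) * forest_fps) m"
  proof (cases m)
    case 0
    then show ?thesis by (simp add: nth[unfolded 0] forests_0 tree_weight_singleton mult.assoc)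
  next
    case (Suc n)
    let ?g = "\<lambda>ts. \<Prod>s\<leftarrow>ts. younger_weight u1 u2 u3 v1 v2 t s"
    have "fps_nth tree_fps m = (\<Sum>us\<in>forests (Suc n). second_weight u1 u2 u3 v1 v2 t (hd us) * ?g (tl us))"
      unfolding nth unfolding Suc by (rule sum.cong) (auto simp: forests_Suc tree_weight_Cons_Cons)
    also have "\<dots> = fps_nth (fps_const t * (fps_const (u2 * v2) + fps_const u3 * (fps_X * tree_fps)) * forest_fps) n"
      unfolding sum_forests_Suc[of "second_weight u1 u2 u3 v1 v2 t" ?g] second_weight_fps[symmetric] fps_mult_nth
      by (simp add: forest_fps_def atLeast0AtMost)
    finally show ?thesis
      by (simp add: Suc mult.assoc)
  qed
qed

end

text \<open>Only the constant terms differ: the convention prescribes \<open>u3\<close>, while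
  \<open>tree_fps\<close> starts with the single edge of weight \<open>u1\<close>.\<close>

lemma M_fps:
  fixes u1 u2 u3 v1 v2 t :: "'a :: comm_ring_1"
  shows "Abs_fps (\<lambda>n. M n u1 u2 u3 v1 v2 t) =
         tree_fps u1 u2 u3 v1 v2 t + fps_const (u3 - u1)"
proof (rule fps_ext)
  fix n
  have 0: "fps_nth (tree_fps u1 u2 u3 v1 v2 t) 0 = u1"
    by (subst tree_fps_eq) (simp add: mult.assoc)
  have "(\<Sum>T\<in>tip_augmented_trees (Suc n). u1 ^ sleaf T * u2 ^ etleaf T * u3 ^ entleaf T *
             v1 ^ yerleaf T * v2 ^ syleaf T * t ^ yedge T) = fps_nth (tree_fps u1 u2 u3 v1 v2 t) n"
    unfolding tree_fps_def fps_nth_Abs_fps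
    by (intro sum.cong refl monomial_eq_tree_weight) (auto simp: tip_augmented_trees_Suc)
  then show "fps_nth (Abs_fps (\<lambda>n. M n u1 u2 u3 v1 v2 t)) n =
      fps_nth (tree_fps u1 u2 u3 v1 v2 t + fps_const (u3 - u1)) n"
    using 0 by (simp add: M_def)
qed

section \<open>The quadratic equation and its root\<close>

lemma M_fps_quadratic:
  fixes u1 u2 u3 v1 v2 t :: "'a :: field"
  assumes "t \<noteq> 0"
  defines "F \<equiv> Abs_fps (\<lambda>n. M n u1 u2 u3 v1 v2 t)"
  shows "fps_X ^ 2 * F ^ 2 + fps_const (u3 * inverse t) + fps_const (u2 * v2 - u3 * v1) * fps_X =
         (fps_const (inverse t) - fps_const v1 * fps_X + fps_const (u3 - u1) * fps_X ^ 2) * F"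
proof -
  define Q where "Q = tree_fps u1 u2 u3 v1 v2 t"
  define H where "H = forest_fps u1 u2 u3 v1 v2 t"
  \<comment> \<open>Atomic names let \<open>algebra\<close> treat the constants as ring variables,
    linked only by \<open>c * d = 1\<close>.\<close>
  define a1 a2 a3 b1 b2 c d where
    "a1 = fps_const u1" "a2 = fps_const u2" "a3 = fps_const u3" "b1 = fps_const v1"
    "b2 = fps_const v2" "c = fps_const t" "d = fps_const (inverse t)"
  note const = this
  have cd: "c * d = 1" using assms by (simp add: const)
  have Q: "Q = a1 + fps_X * (c * (a2 * b2 + a3 * (fps_X * Q))) * H"
    using tree_fps_eq[of u1 u2 u3 v1 v2 t] by (simp add: Q_def H_def const)
  have H: "H = 1 + fps_X * (c * (b1 + fps_X * Q)) * H"
    using forest_fps_eq[of u1 u2 u3 v1 v2 t] by (simp add: Q_def H_def const)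
  have F: "F = Q + a3 - a1"
    by (simp add: F_def M_fps Q_def const flip: fps_const_sub)
  \<comment> \<open>By its own equation, \<open>H\<close> is inverse to the second factor on the
    left, so multiplying the equation for \<open>Q\<close> by that factor eliminates
    \<open>H\<close>.\<close>
  have Q': "(Q - a1) * (1 - fps_X * (c * (b1 + fps_X * Q))) =
        fps_X * (c * (a2 * b2 + a3 * (fps_X * Q)))"
    using Q H by algebra
  \<comment> \<open>This is \<open>Q'\<close> times \<open>d\<close>, rewritten with
    \<open>Q = F - a3 + a1\<close>.\<close>
  have "fps_X ^ 2 * F ^ 2 + a3 * d + (a2 * b2 - a3 * b1) * fps_X =
      (d - b1 * fps_X + (a3 - a1) * fps_X ^ 2) * F"
    using Q' cd unfolding F by algebra
  then show ?thesis
    by (simp add: const flip: fps_const_sub fps_const_mult)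
qed

theorem theorem4p2:
  fixes u1 u2 u3 v1 v2 t :: "'a :: field_char_0"
    and num disc :: "'a fps"
  assumes "t \<noteq> 0"
  defines "num \<equiv> fps_const (inverse t) - fps_const v1 * fps_X + fps_const (u3 - u1) * fps_X ^ 2"
    and "disc \<equiv> fps_const (inverse t ^ 2) - fps_const (2 * inverse t * v1) * fps_X
           + fps_const (v1 ^ 2 - 2 * inverse t * (u1 + u3)) * fps_X ^ 2
           + fps_const (2 * u1 * v1 + 2 * u3 * v1 - 4 * u2 * v2) * fps_X ^ 3
           + fps_const ((u1 - u3) ^ 2) * fps_X ^ 4"
  shows "(\<exists>!S. S ^ 2 = disc \<and> fps_nth S 0 = inverse t) \<and>
         (\<forall>S. S ^ 2 = disc \<and> fps_nth S 0 = inverse t \<longrightarrow>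
            2 * fps_X ^ 2 dvd num - S \<and>
            Abs_fps (\<lambda>n. M n u1 u2 u3 v1 v2 t) = (num - S) / (2 * fps_X ^ 2))"
proof -
  define F where "F = Abs_fps (\<lambda>n. M n u1 u2 u3 v1 v2 t)"
  have disc: "(num - 2 * fps_X ^ 2 * F) ^ 2 = disc"
  proof -
    have quad: "fps_X ^ 2 * F ^ 2 + fps_const (u3 * inverse t) + fps_const (u2 * v2 - u3 * v1) * fps_X =
        num * F"
      using M_fps_quadratic[OF \<open>t \<noteq> 0\<close>] unfolding F_def num_def .
    \<comment> \<open>The radicand is the discriminant of \<open>quad\<close>; completing the square
      then gives the claim.\<close>
    have "disc = num ^ 2 - 4 * fps_X ^ 2 *
        (fps_const (u3 * inverse t) + fps_const (u2 * v2 - u3 * v1) * fps_X)"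
      unfolding disc_def num_def
      by (simp add: power2_eq_square algebra_simps eval_nat_numeral
          flip: numeral_fps_const fps_const_sub fps_const_mult fps_const_add)
    then show ?thesis
      using quad by algebra
  qed
  have const: "fps_nth (num - 2 * fps_X ^ 2 * F) 0 = inverse t"
    by (simp add: num_def)
  have unique: "S = num - 2 * fps_X ^ 2 * F" if "S ^ 2 = disc" "fps_nth S 0 = inverse t" for S
  proof -
    \<comment> \<open>Power series over a field form an integral domain, so square roots agree up to
      sign; the nonzero constant term fixes the sign in characteristic 0.\<close>
    have "S = num - 2 * fps_X ^ 2 * F \<or> S = - (num - 2 * fps_X ^ 2 * F)"
      using that(1) disc by (metis power2_eq_iff)
    moreover have "inverse t \<noteq> - inverse t"
      using \<open>t \<noteq> 0\<close> by simp
    ultimately show ?thesis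
      using that(2) const by (metis fps_neg_nth)
  qed
  have "2 * fps_X ^ 2 dvd num - S \<and> F = (num - S) / (2 * fps_X ^ 2)"
    if "S ^ 2 = disc" "fps_nth S 0 = inverse t" for S
  proof -
    \<comment> \<open>An explicit multiple of the divisor, so the division is exact.\<close>
    have "num - S = 2 * fps_X ^ 2 * F"
      using unique[OF that] by simp
    moreover have "2 * fps_X ^ 2 \<noteq> (0 :: 'a fps)"
      by simp
    ultimately show ?thesis
      by (metis dvd_triv_left nonzero_mult_div_cancel_left)
  qed
  then show ?thesis
    using disc const unique unfolding F_def by blast
qed

end
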